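(* Let $n\ge 1$ be an integer and let $\alpha_i,\beta_i,\gamma_i$ ($i=1,\dots,n$) be real numbers with $\min(\alpha_i,\gamma_i)\ge 1$ and $\beta_i>0$ for all $i=1,\dots,n$, and with $\alpha_j+\beta_j\ge 2$ for some $j\in\{1,\dots,n\}$. Let $$\mathcal{F}(z)=\sum_{m=0}^{\infty}\frac{z^{m}}{\prod_{i=1}^{n}[\Gamma(\alpha_i m+\beta_i)]^{\gamma_i}}.$$ If $\prod_{i=1}^{n}[\Gamma(\beta_i)]^{\gamma_i}=1$ and $\prod_{i=1}^{n}[\Gamma(\alpha_i+\beta_i)]^{\gamma_i}>e$, then $\mathcal{F}$ is subordinate to the exponential function $e^{z}$ on the open unit disk $\mathcal{D}=\{z\in\mathbb{C}:|z|<1\}$.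
   Context: $\Gamma$ is the Euler gamma function. The function $\mathcal{F}$ is called the generalized (multi-index) Le Roy type function of $3n$ parameters. Subordination: an analytic function $f$ on $\mathcal{D}$ is subordinate to an analytic univalent function $g$ on $\mathcal{D}$ if there exists a Schwarz function $w$, i.e. an analytic function on $\mathcal{D}$ with $w(0)=0$ and $|w(z)|\le|z|<1$, such that $f(z)=g(w(z))$ for all $z\in\mathcal{D}$ (equivalently, $f(0)=g(0)$ and $f(\mathcal{D})\subset g(\mathcal{D})$). *)

theory Defs
  imports "HOL-Complex_Analysis.Complex_Analysis"
begin

text \<open>The parameter families are indexed by \<open>{1..n}\<close>; their values outside this range are
  irrelevant. Real powers are written with \<open>powr\<close>, which is the usual power here because
  \<open>Gamma\<close> is positive on positive reals.\<close>

definition le_roy_type ::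
    "nat \<Rightarrow> (nat \<Rightarrow> real) \<Rightarrow> (nat \<Rightarrow> real) \<Rightarrow> (nat \<Rightarrow> real) \<Rightarrow> complex \<Rightarrow> complex" where
  "le_roy_type n \<alpha> \<beta> \<gamma> z =
     (\<Sum>m. z ^ m / of_real (\<Prod>i=1..n. Gamma (\<alpha> i * real m + \<beta> i) powr \<gamma> i))"

definition schwarz_function :: "(complex \<Rightarrow> complex) \<Rightarrow> bool" where
  "schwarz_function w \<longleftrightarrow>
     w analytic_on ball 0 1 \<and> w 0 = 0 \<and> (\<forall>z\<in>ball 0 1. norm (w z) \<le> norm z)"

text \<open>Analyticity of both functions and univalence of the superordinate one are part of the
  relation.\<close>

definition subordinate :: "(complex \<Rightarrow> complex) \<Rightarrow> (complex \<Rightarrow> complex) \<Rightarrow> bool" where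
  "subordinate f g \<longleftrightarrow>
     f analytic_on ball 0 1 \<and> g analytic_on ball 0 1 \<and> inj_on g (ball 0 1) \<and>
     (\<exists>w. schwarz_function w \<and> (\<forall>z\<in>ball 0 1. f z = g (w z)))"

end

theory Submission imports Defs begin

text \<open>
  The image of the unit disc under \<open>exp\<close> contains the disc of radius \<open>1 - 1/e\<close> about \<open>1\<close>:
  comparing Taylor coefficients, \<open>\<bar>Ln (1 + u)\<bar> \<le> - ln (1 - \<bar>u\<bar>)\<close>, and the right-hand side is below
  \<open>1\<close> exactly when \<open>\<bar>u\<bar> < 1 - 1/e\<close>. A function with value \<open>1\<close> at the origin that stays in this disc
  is therefore subordinate to \<open>exp\<close>: its logarithm maps the unit disc into itself and fixes \<open>0\<close>, so
  the Schwarz lemma makes it a Schwarz function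
  (\<open>subordinate_exp_if_near_one\<close>).

  Write \<open>c m\<close> for the denominator of the \<open>m\<close>-th Le Roy coefficient. The hypotheses say \<open>c 0 = 1\<close> and
  \<open>c 1 > e\<close>, and it suffices to know \<open>c m \<ge> m! c 1\<close> for \<open>m \<ge> 1\<close>
  (\<open>fact_times_le_roy_denominator_le\<close>): then \<open>\<bar>F z - 1\<bar> \<le> (e - 1) / c 1 < 1 - 1/e\<close>. Log-convexity of
  \<open>Gamma\<close> supplies this growth. It gives \<open>Gamma (x + a) / Gamma x \<ge> x powr a\<close> for \<open>a \<ge> 1\<close>, so for
  \<open>m \<ge> 1\<close> and \<open>x = \<alpha> i m + \<beta> i > 1\<close> every factor of \<open>c (m + 1) / c m\<close> is at least \<open>x \<ge> 1\<close>, and the factor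
  of an index with \<open>\<alpha> j + \<beta> j \<ge> 2\<close> is at least \<open>m + 1\<close>.
\<close>

text \<open>The chord of the convex function \<open>ln \<circ> Gamma\<close> over \<open>[x, x + a]\<close> is at least as steep as the one
  over \<open>[x, x + 1]\<close>, whose slope is \<open>ln x\<close> by the functional equation.\<close>

lemma powr_times_Gamma_le_Gamma_plus:
  fixes x a :: real
  assumes "x > 0" "a \<ge> 1"
  shows "x powr a * Gamma x \<le> Gamma (x + a)"
proof -
  have "x \<notin> \<int>\<^sub>\<le>\<^sub>0"
    using assms by (auto dest: nonpos_Ints_nonpos)
  then have Gamma_step: "Gamma (x + 1) = x * Gamma x"
    by (rule Gamma_plus1)
  show ?thesis
  proof (cases "a = 1")
    case True
    then show ?thesis
      using Gamma_step assms by simp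
  next
    case False
    with assms have a: "a > 1" by simp
    have pos: "Gamma x > 0" "Gamma (x + a) > 0"
      using assms by (auto intro!: Gamma_real_pos)
    have step: "ln (Gamma (x + 1)) = ln x + ln (Gamma x)"
      unfolding Gamma_step using assms(1) pos(1) by (rule ln_mult_pos)
    have "((ln \<circ> Gamma) x - (ln \<circ> Gamma) (x + 1)) / (x - (x + 1))
        \<le> ((ln \<circ> Gamma) x - (ln \<circ> Gamma) (x + a)) / (x - (x + a))"
      using assms a by (intro convex_on_slope_le[OF log_convex_Gamma_real]) auto
    then have "ln x \<le> (ln (Gamma (x + a)) - ln (Gamma x)) / a"
      by (simp add: step diff_divide_distrib)
    then have "a * ln x + ln (Gamma x) \<le> ln (Gamma (x + a))"
      using a by (simp add: field_simps)
    then have "exp (a * ln x + ln (Gamma x)) \<le> exp (ln (Gamma (x + a)))"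
      by simp
    then show ?thesis
      using pos assms by (simp add: exp_add powr_def)
  qed
qed

lemma times_Gamma_powr_le:
  fixes x a c :: real
  assumes "x \<ge> 1" "a \<ge> 1" "c \<ge> 1"
  shows "x * Gamma x powr c \<le> Gamma (x + a) powr c"
proof -
  have pos: "Gamma x > 0"
    using assms by (auto intro!: Gamma_real_pos)
  have "x powr 1 \<le> x powr (a * c)"
    using assms mult_mono[of 1 a 1 c] by (intro powr_mono) auto
  then have "x * Gamma x powr c \<le> x powr (a * c) * Gamma x powr c"
    using assms by (intro mult_right_mono) auto
  also have "\<dots> = (x powr a * Gamma x) powr c"
    using assms pos by (simp add: powr_mult powr_powr)
  also have "\<dots> \<le> Gamma (x + a) powr c"
    using assms pos by (intro powr_mono2 powr_times_Gamma_le_Gamma_plus) auto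
  finally show ?thesis .
qed

definition le_roy_denominator ::
    "nat \<Rightarrow> (nat \<Rightarrow> real) \<Rightarrow> (nat \<Rightarrow> real) \<Rightarrow> (nat \<Rightarrow> real) \<Rightarrow> nat \<Rightarrow> real" where
  "le_roy_denominator n \<alpha> \<beta> \<gamma> m = (\<Prod>i=1..n. Gamma (\<alpha> i * real m + \<beta> i) powr \<gamma> i)"

context
  fixes n :: nat and \<alpha> \<beta> \<gamma> :: "nat \<Rightarrow> real"
  assumes \<alpha>: "\<And>i. i \<in> {1..n} \<Longrightarrow> \<alpha> i \<ge> 1"
    and \<gamma>: "\<And>i. i \<in> {1..n} \<Longrightarrow> \<gamma> i \<ge> 1"
    and \<beta>: "\<And>i. i \<in> {1..n} \<Longrightarrow> \<beta> i > 0"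
    and large: "\<exists>j\<in>{1..n}. \<alpha> j + \<beta> j \<ge> 2"
begin

text \<open>All factors of the quotient of consecutive denominators are at least \<open>1\<close>, so a single
  index \<open>j\<close> already yields the factor \<open>m + 1\<close>; here
  \<open>\<alpha> j * m + \<beta> j = (\<alpha> j + \<beta> j) + \<alpha> j * (m - 1) \<ge> 2 + (m - 1)\<close>.\<close>

lemma le_roy_denominator_Suc_ge:
  assumes "m \<ge> 1"
  shows "real (Suc m) * le_roy_denominator n \<alpha> \<beta> \<gamma> m \<le> le_roy_denominator n \<alpha> \<beta> \<gamma> (Suc m)"
proof -
  define x where "x i = \<alpha> i * real m + \<beta> i" for i
  have x_ge: "x i \<ge> \<alpha> i + \<beta> i + (real m - 1)" if "i \<in> {1..n}" for i
    using mult_right_mono[OF \<alpha>[OF that], of "real m - 1"] assms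
    by (simp add: x_def algebra_simps)
  then have x_ge_1: "x i \<ge> 1" if "i \<in> {1..n}" for i
    using \<alpha>[OF that] \<beta>[OF that] that assms by (smt (verit) of_nat_1 of_nat_le_iff)
  obtain j where j: "j \<in> {1..n}" "\<alpha> j + \<beta> j \<ge> 2"
    using large by blast
  have "real (Suc m) \<le> x j"
    using x_ge[OF j(1)] j(2) by simp
  also have "x j \<le> (\<Prod>i=1..n. x i)"
    using prod_mono2[of "{1..n}" "{j}" x] j x_ge_1 by fastforce
  finally have "real (Suc m) * (\<Prod>i=1..n. Gamma (x i) powr \<gamma> i)
      \<le> (\<Prod>i=1..n. x i) * (\<Prod>i=1..n. Gamma (x i) powr \<gamma> i)"
    by (intro mult_right_mono prod_nonneg) auto
  also have "\<dots> = (\<Prod>i=1..n. x i * Gamma (x i) powr \<gamma> i)"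
    by (simp add: prod.distrib)
  also have "\<dots> \<le> (\<Prod>i=1..n. Gamma (x i + \<alpha> i) powr \<gamma> i)"
    using x_ge_1 \<alpha> \<gamma> by (intro prod_mono conjI times_Gamma_powr_le mult_nonneg_nonneg) force+
  finally show ?thesis
    by (simp add: le_roy_denominator_def x_def algebra_simps)
qed

lemma fact_times_le_roy_denominator_le:
  assumes "m \<ge> 1"
  shows "fact m * le_roy_denominator n \<alpha> \<beta> \<gamma> 1 \<le> le_roy_denominator n \<alpha> \<beta> \<gamma> m"
  using assms
proof (induction m rule: dec_induct)
  case base
  then show ?case by simp
next
  case (step m)
  have "fact (Suc m) * le_roy_denominator n \<alpha> \<beta> \<gamma> 1
      = real (Suc m) * (fact m * le_roy_denominator n \<alpha> \<beta> \<gamma> 1)"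
    by simp
  also have "\<dots> \<le> real (Suc m) * le_roy_denominator n \<alpha> \<beta> \<gamma> m"
    using step by (intro mult_left_mono) auto
  also have "\<dots> \<le> le_roy_denominator n \<alpha> \<beta> \<gamma> (Suc m)"
    using step by (intro le_roy_denominator_Suc_ge) auto
  finally show ?case .
qed

end

text \<open>The Taylor coefficients of \<open>Ln (1 + u)\<close> have absolute values \<open>1 / m\<close>, which are those of
  \<open>- ln (1 - x)\<close>.\<close>

lemma norm_Ln_one_plus_le:
  fixes u :: complex
  assumes "norm u < 1"
  shows "norm (Ln (1 + u)) \<le> - ln (1 - norm u)"
proof -
  have "(\<lambda>m. - ((- u) ^ m) / of_nat m) sums Ln (1 + u)"
    using assms by (rule Ln_series')
  moreover have "(\<lambda>m. - (- (norm u ^ m) / real m)) sums - ln (1 - norm u)"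
    using sums_minus[OF ln_series'[of "- norm u"]] assms by simp
  ultimately show ?thesis
    using norm_sums_le[of "\<lambda>m. - ((- u) ^ m) / of_nat m" _ "\<lambda>m. - (- (norm u ^ m) / real m)"]
    by (simp add: norm_divide norm_power)
qed

lemma subordinate_exp_if_near_one:
  assumes f: "f analytic_on ball 0 1" "f 0 = 1"
    and near: "\<And>z. z \<in> ball 0 1 \<Longrightarrow> norm (f z - 1) < 1 - exp (-1)"
  shows "subordinate f exp"
proof -
  have Ln_less: "norm (Ln (f z)) < 1" if "z \<in> ball 0 1" for z
  proof -
    have less: "exp (-1) < 1 - norm (f z - 1)"
      using near[OF that] by linarith
    then have "ln (exp (-1)) < ln (1 - norm (f z - 1))"
      by (smt (verit) exp_gt_zero ln_less_cancel_iff)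
    moreover have "norm (f z - 1) < 1"
      using less exp_gt_zero[of "-1 :: real"] by linarith
    ultimately show ?thesis
      using norm_Ln_one_plus_le[of "f z - 1"] by simp
  qed
  have off_cut: "f z \<notin> \<real>\<^sub>\<le>\<^sub>0" if "z \<in> ball 0 1" for z
  proof
    assume "f z \<in> \<real>\<^sub>\<le>\<^sub>0"
    then have "Re (f z) \<le> 0"
      by (auto elim: nonpos_Reals_cases)
    then have "1 \<le> norm (f z - 1)"
      using abs_Re_le_cmod[of "f z - 1"] by simp
    then show False
      using near[OF that] exp_gt_zero[of "-1 :: real"] by linarith
  qed
  have holo: "(\<lambda>z. Ln (f z)) holomorphic_on ball 0 1"
    using analytic_imp_holomorphic[OF f(1)] off_cut by (intro holomorphic_on_Ln') auto
  have "schwarz_function (\<lambda>z. Ln (f z))"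
    unfolding schwarz_function_def
    using Schwarz_Lemma(1)[OF holo] Ln_less f(2) holo by (auto simp: analytic_on_open)
  moreover have "f z = exp (Ln (f z))" if "z \<in> ball 0 1" for z
    using off_cut[OF that] by (metis exp_Ln nonpos_Reals_zero_I)
  moreover have "inj_on exp (ball (0 :: complex) 1)"
    by (rule inj_on_subset[OF inj_on_exp_pi[of 0]]) (use pi_gt3 in auto)
  ultimately show ?thesis
    unfolding subordinate_def using f(1) by (auto intro!: analytic_intros)
qed

text \<open>Majorising termwise by \<open>K * z ^ m / m!\<close> leaves, apart from the constant term \<open>1\<close>, at most
  \<open>K\<close> times the exponential series without its first term.\<close>

lemma power_series_near_one:
  fixes a :: "nat \<Rightarrow> complex"
  assumes a0: "a 0 = 1" and a: "\<And>m. m \<ge> 1 \<Longrightarrow> norm (a m) \<le> K / fact m"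
    and z: "norm z \<le> 1"
  shows "summable (\<lambda>m. a m * z ^ m)"
    and "norm ((\<Sum>m. a m * z ^ m) - 1) \<le> K * (exp 1 - 1)"
proof -
  have "(\<lambda>m. inverse (fact m) * 1 ^ m) sums exp (1 :: real)"
    using exp_converges[of "1 :: real"] by (simp add: scaleR_conv_of_real)
  then have "(\<lambda>m. inverse (fact (Suc m)) * 1 ^ Suc m) sums (exp 1 - 1 :: real)"
    by (subst sums_Suc_iff) simp
  then have major: "(\<lambda>m. K / fact (Suc m)) sums (K * (exp 1 - 1))"
    using sums_mult[of _ _ K] by (simp only: power_one mult_1_right divide_inverse)
  have term_le: "norm (a (Suc m) * z ^ Suc m) \<le> K / fact (Suc m)" for m
  proof -
    have "norm (a (Suc m) * z ^ Suc m) \<le> norm (a (Suc m)) * 1"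
      unfolding norm_mult norm_power using z by (intro mult_left_mono power_le_one) auto
    also have "\<dots> \<le> K / fact (Suc m)"
      using a[of "Suc m"] by simp
    finally show ?thesis .
  qed
  have tail: "summable (\<lambda>m. a (Suc m) * z ^ Suc m)"
    by (rule summable_comparison_test'[OF sums_summable[OF major] term_le])
  then show summable: "summable (\<lambda>m. a m * z ^ m)"
    using summable_Suc_iff[of "\<lambda>m. a m * z ^ m"] by blast
  have "(\<Sum>m. a m * z ^ m) - 1 = (\<Sum>m. a (Suc m) * z ^ Suc m)"
    using suminf_split_head[OF summable] a0 by simp
  then show "norm ((\<Sum>m. a m * z ^ m) - 1) \<le> K * (exp 1 - 1)"
    using norm_sums_le[OF summable_sums[OF tail] major term_le] by simp
qed

theorem theorem2:
  fixes n :: nat and \<alpha> \<beta> \<gamma> :: "nat \<Rightarrow> real"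
  assumes "n \<ge> 1"
    and "\<And>i. i \<in> {1..n} \<Longrightarrow> min (\<alpha> i) (\<gamma> i) \<ge> 1"
    and "\<And>i. i \<in> {1..n} \<Longrightarrow> \<beta> i > 0"
    and "\<exists>j\<in>{1..n}. \<alpha> j + \<beta> j \<ge> 2"
    and "(\<Prod>i=1..n. Gamma (\<beta> i) powr \<gamma> i) = 1"
    and "(\<Prod>i=1..n. Gamma (\<alpha> i + \<beta> i) powr \<gamma> i) > exp 1"
  shows "subordinate (le_roy_type n \<alpha> \<beta> \<gamma>) exp"
proof (rule subordinate_exp_if_near_one)
  define c where "c = le_roy_denominator n \<alpha> \<beta> \<gamma>"
  define a where "a m = complex_of_real (inverse (c m))" for m
  have F_eq: "le_roy_type n \<alpha> \<beta> \<gamma> z = (\<Sum>m. a m * z ^ m)" for z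
    by (simp add: le_roy_type_def a_def c_def le_roy_denominator_def field_simps)
  have a0: "a 0 = 1"
    using assms(5) by (simp add: a_def c_def le_roy_denominator_def)
  have c1: "c 1 > exp 1"
    using assms(6) by (simp add: c_def le_roy_denominator_def)
  then have c1_pos: "c 1 > 0"
    using exp_gt_zero[of "1 :: real"] by linarith
  have a_le: "norm (a m) \<le> inverse (c 1) / fact m" if "m \<ge> 1" for m
  proof -
    have le: "fact m * c 1 \<le> c m"
      unfolding c_def using that assms(2-4) by (intro fact_times_le_roy_denominator_le) auto
    moreover have pos: "0 < fact m * c 1"
      using c1_pos by simp
    ultimately have "inverse (c m) \<le> inverse (fact m * c 1)"
      by (rule le_imp_inverse_le)
    moreover have "norm (a m) = inverse (c m)"
      using le pos unfolding a_def norm_of_real by simp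
    ultimately show ?thesis
      by (simp add: field_simps)
  qed
  note series = power_series_near_one[of a "inverse (c 1)", OF a0 a_le]
  show "le_roy_type n \<alpha> \<beta> \<gamma> analytic_on ball 0 1"
    using series(1) by (intro power_series_analytic[where a = a]) (simp add: F_eq summable_sums)
  show "le_roy_type n \<alpha> \<beta> \<gamma> 0 = 1"
    using a0 by (simp add: F_eq powser_zero)
  show "norm (le_roy_type n \<alpha> \<beta> \<gamma> z - 1) < 1 - exp (-1)" if "z \<in> ball 0 1" for z
  proof -
    have "norm (le_roy_type n \<alpha> \<beta> \<gamma> z - 1) \<le> inverse (c 1) * (exp 1 - 1)"
      using series(2)[of z] that by (simp add: F_eq)
    also have "\<dots> < inverse (exp 1) * (exp 1 - 1)"
      using c1 by (intro mult_strict_right_mono less_imp_inverse_less) auto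
    also have "\<dots> = 1 - exp (-1)"
      by (simp add: exp_minus field_simps)
    finally show ?thesis .
  qed
qed

end
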